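(* Let $\pi^{\star}\in\Pi$ be a linear state feedback policy, given by $u_k = K^{\star}_k x_k$ with $K^{\star}_k\in\mathbb{R}^{m\times n}$ for $k=0,\dots,T-1$, which is a minimizer over $\pi \in \Pi$ of the worst-case risk $\sup_{\mathbb{P}_{\mathbf{x}},\mathbb{P}_w}\rho_0[J_T(\pi,\mathbf{x},\mathbf{w})]$, where $\rho_0$ is a risk functional other than the expectation. Let $(\breve{\mathbf{x}},\breve{\mathbf{w}})$ and $(\mathbf{x}^{\star},\mathbf{w}^{\star})$ be two admissible state/disturbance trajectories of the system under the policy $\pi^{\star}$: the first ("true") has initial state law $\breve{\mathbb{P}}_{x_0}\in\mathcal{P}^{x_0}$ and disturbance law $\breve{\mathbb{P}}_w\in\mathcal{P}^w$, and the second ("worst-case") has initial state law $\mathbb{P}^{\star}_{x_0}\in\mathcal{P}^{x_0}$ and disturbance law $\mathbb{P}^{\star}_w\in\mathcal{P}^w$. Then, even when the true distributions of the states $\breve{x}_k$, $k=0,\dots,T$, and of the disturbance are different from their worst-case counterparts, the pseudo distributional regret of $\pi^{\star}$ vanishes: $$\bar{\mathbf{R}}(T,\pi^{\star}) := \mathbb{E}\left[J_T(\pi^{\star},\breve{\mathbf{x}},\breve{\mathbf{w}})\right]-\mathbb{E}\left[J_T(\pi^{\star},\mathbf{x}^{\star},\mathbf{w}^{\star})\right]=0 .$$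
   Context: System: $x_{k+1}=Ax_k+Bu_k+Dw_k$ for $k=0,\dots,T-1$, with $T\in\mathbb{N}$, $x_k\in\mathbb{R}^n$, $u_k\in\mathbb{R}^m$, $w_k\in\mathbb{R}^r$, real matrices $A\in\mathbb{R}^{n\times n}$, $B\in\mathbb{R}^{n\times m}$, $D\in\mathbb{R}^{n\times r}$; the pair $(A,B)$ is assumed stabilizable and the noise-free system is assumed controllable. Write $\mathbf{x}=(x_0,\dots,x_T)$ and $\mathbf{w}=(w_0,\dots,w_{T-1})$, and let $\mathbb{P}_{\mathbf{x}}=(\mathbb{P}_{x_0},\dots,\mathbb{P}_{x_T})$ be the tuple of laws of the states. Cost: with $Q\succeq 0$, $R\succ 0$ and $\|x\|_Q^2=x^{\top}Qx$, the random cost is $$J_T(\pi,\mathbf{x},\mathbf{w})=\|x_T\|_Q^2+\sum_{k=0}^{T-1}\left(\|x_k\|_Q^2+\|u_k\|_R^2\right),$$ where the states evolve under the policy $\pi$, that is, $u_k$ is the input chosen by $\pi$ at time $k$. Ambiguity sets: for fixed $\Sigma_w$, $\mu_{x_0}$, $\Sigma_{x_0}$, $$\mathcal{P}^w=\{\mathbb{P}_w \text{ on } \mathbb{R}^r \text{ with finite second moment}: \mathbb{E}[w]=0,\ \mathbb{E}[ww^{\top}]=\Sigma_w\},$$ $$\mathcal{P}^{x_0}=\{\mathbb{P}_{x_0} \text{ on } \mathbb{R}^n \text{ with finite second moment}: \mathbb{E}[x_0]=\mu_{x_0},\ \mathbb{E}[(x_0-\mu_{x_0})(x_0-\mu_{x_0})^{\top}]=\Sigma_{x_0}\}.$$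 Admissible trajectories (standing assumptions): $x_0\sim\mathbb{P}_{x_0}\in\mathcal{P}^{x_0}$; all $w_k$ have the same law $\mathbb{P}_w\in\mathcal{P}^w$; $\mathbb{E}[w_kw_j^{\top}]=0$ for $k\ne j$; and $x_0$ is independent of $w_k$ for every $k$. Policies: $\Pi$ is the set of (causal) linear state feedback policies. A risk functional is a map from real random variables to $\mathbb{R}\cup\{\infty\}$. The supremum $\sup_{\mathbb{P}_{\mathbf{x}},\mathbb{P}_w}$ ranges over the state and disturbance laws arising from admissible trajectories under $\pi$. *)

theory Defs
  imports "HOL-Probability.Probability"
begin

subsection \<open>Linear algebra and linear systems\<close>

definition outer :: "real^'i \<Rightarrow> real^'j \<Rightarrow> real^'j^'i"
  where "outer x y = (\<chi> i j. x $ i * y $ j)"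

definition quad_norm :: "real^'i^'i \<Rightarrow> real^'i \<Rightarrow> real"
  where "quad_norm Q x = x \<bullet> (Q *v x)"

definition pos_semidef :: "real^'i^'i \<Rightarrow> bool"
  where "pos_semidef Q \<longleftrightarrow> transpose Q = Q \<and> (\<forall>x. x \<bullet> (Q *v x) \<ge> 0)"

definition pos_def :: "real^'i^'i \<Rightarrow> bool"
  where "pos_def Q \<longleftrightarrow> transpose Q = Q \<and> (\<forall>x. x \<noteq> 0 \<longrightarrow> x \<bullet> (Q *v x) > 0)"

text \<open>Discrete time: all complex eigenvalues lie in the open unit disc.\<close>

definition schur_stable :: "real^'n^'n \<Rightarrow> bool"
  where "schur_stable F \<longleftrightarrow>
    (\<forall>(z::complex) (v::complex^'n). v \<noteq> 0 \<and> map_matrix complex_of_real F *v v = z *s v \<longrightarrow> cmod z < 1)"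

definition stabilizable :: "real^'n^'n \<Rightarrow> real^'m^'n \<Rightarrow> bool"
  where "stabilizable A B \<longleftrightarrow> (\<exists>K::real^'n^'m. schur_stable (A + B ** K))"

definition controllable :: "real^'n^'n \<Rightarrow> real^'m^'n \<Rightarrow> bool"
  where "controllable A B \<longleftrightarrow>
    (\<forall>a b. \<exists>N (x::nat \<Rightarrow> real^'n) (u::nat \<Rightarrow> real^'m).
       x 0 = a \<and> (\<forall>k<N. x (Suc k) = A *v x k + B *v u k) \<and> x N = b)"

subsection \<open>Ambiguity sets\<close>

text \<open>
  The set of laws with finite second moment, mean \<open>\<mu>\<close> and covariance \<open>\<Sigma>\<close>.
  The ambiguity set of the disturbances is \<open>ambiguity_set 0 \<Sigma>\<^sub>w\<close>, that of the initial
  state is \<open>ambiguity_set \<mu>\<^sub>0 \<Sigma>\<^sub>0\<close>.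
\<close>

definition ambiguity_set :: "real^'i \<Rightarrow> real^'i^'i \<Rightarrow> (real^'i) measure set"
  where "ambiguity_set \<mu> \<Sigma> =
    {P. prob_space P \<and> sets P = sets borel \<and> integrable P (\<lambda>v. (norm v)\<^sup>2) \<and>
        (\<integral>v. v \<partial>P) = \<mu> \<and> (\<integral>v. outer (v - \<mu>) (v - \<mu>) \<partial>P) = \<Sigma>}"

subsection \<open>Policies, trajectories and cost\<close>

text \<open>A policy maps a time and the current state to an input; only times \<open>k < T\<close> matter.\<close>

type_synonym ('n, 'm) policy = "nat \<Rightarrow> real^'n \<Rightarrow> real^'m"

definition linear_policies :: "nat \<Rightarrow> ('n::finite, 'm::finite) policy set"
  where "linear_policies T =
    {\<pi>. \<exists>K :: nat \<Rightarrow> real^'n^'m. \<forall>k<T. \<forall>v. \<pi> k v = K k *v v}"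

text \<open>
  Independence of random vectors. The constant \<open>prob_space.indep_var\<close> requires both variables
  to have the same type, so it is unfolded here to independence of the generated sigma-algebras.
\<close>

definition indep_rv :: "'a measure \<Rightarrow> ('a \<Rightarrow> 'b::topological_space) \<Rightarrow> ('a \<Rightarrow> 'c::topological_space) \<Rightarrow> bool"
  where "indep_rv M X Y \<longleftrightarrow>
    X \<in> borel_measurable M \<and> Y \<in> borel_measurable M \<and>
    prob_space.indep_set M {X -` S \<inter> space M | S. S \<in> sets borel} {Y -` S \<inter> space M | S. S \<in> sets borel}"

text \<open>
  An admissible trajectory on the probability space \<open>M\<close> under the policy \<open>\<pi>\<close>, with initial
  state law \<open>P0\<close> and common disturbance law \<open>Pw\<close>. The states are \<open>x 0, \<dots>, x T\<close> and the
  disturbances \<open>w 0, \<dots>, w (T - 1)\<close>; values at larger indices are irrelevant. The disturbances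
  are only assumed to be pairwise uncorrelated, and the initial state to be independent of each
  single disturbance.
\<close>

definition admissible ::
  "real^'n^'n \<Rightarrow> real^'m^'n \<Rightarrow> real^'r^'n \<Rightarrow> nat \<Rightarrow> ('n::finite, 'm::finite) policy \<Rightarrow>
   (real^'n) measure \<Rightarrow> (real^'r) measure \<Rightarrow>
   'a measure \<Rightarrow> (nat \<Rightarrow> 'a \<Rightarrow> real^'n) \<Rightarrow> (nat \<Rightarrow> 'a \<Rightarrow> real^'r) \<Rightarrow> bool"
  where "admissible A B D T \<pi> P0 Pw M x w \<longleftrightarrow>
    prob_space M \<and>
    (\<forall>k\<le>T. x k \<in> borel_measurable M) \<and>
    (\<forall>k<T. w k \<in> borel_measurable M) \<and>
    (\<forall>k<T. \<forall>\<omega>\<in>space M. x (Suc k) \<omega> = A *v x k \<omega> + B *v \<pi> k (x k \<omega>) + D *v w k \<omega>) \<and>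
    distr M borel (x 0) = P0 \<and>
    (\<forall>k<T. distr M borel (w k) = Pw) \<and>
    (\<forall>k<T. \<forall>j<T. k \<noteq> j \<longrightarrow> (\<integral>\<omega>. outer (w k \<omega>) (w j \<omega>) \<partial>M) = 0) \<and>
    (\<forall>k<T. indep_rv M (x 0) (w k))"

text \<open>
  The disturbances enter the cost only through the states, so they are not an argument of
  \<open>cost\<close>; the dynamics linking states, inputs and disturbances are part of \<open>admissible\<close>.
\<close>

definition cost ::
  "real^'n^'n \<Rightarrow> real^'m^'m \<Rightarrow> nat \<Rightarrow> ('n::finite, 'm::finite) policy \<Rightarrow>
   (nat \<Rightarrow> 'a \<Rightarrow> real^'n) \<Rightarrow> 'a \<Rightarrow> real"
  where "cost Q R T \<pi> x \<omega> =
    quad_norm Q (x T \<omega>) + (\<Sum>k<T. quad_norm Q (x k \<omega>) + quad_norm R (\<pi> k (x k \<omega>)))"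

subsection \<open>Risk\<close>

text \<open>
  A risk functional acts on a random variable together with the probability space carrying it,
  and takes values in the reals extended by \<open>\<infinity>\<close>; it need not be law invariant.
\<close>

type_synonym 'a risk = "'a measure \<Rightarrow> ('a \<Rightarrow> real) \<Rightarrow> ereal"

definition risk_functional :: "'a risk \<Rightarrow> bool"
  where "risk_functional \<rho> \<longleftrightarrow>
    (\<forall>M X. prob_space M \<and> X \<in> borel_measurable M \<longrightarrow> \<rho> M X \<noteq> -\<infinity>)"

text \<open>The comparison is made on integrable variables, where the expectation is defined.\<close>

definition is_expectation :: "'a risk \<Rightarrow> bool"
  where "is_expectation \<rho> \<longleftrightarrow>
    (\<forall>M X. prob_space M \<and> integrable M X \<longrightarrow> \<rho> M X = ereal (prob_space.expectation M X))"

text \<open>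
  The law of the cost is not determined by the marginal laws of the states and disturbances, so
  the supremum runs over all admissible trajectories realizing laws in the ambiguity sets.
\<close>

definition worst_case_risk ::
  "real^'n^'n \<Rightarrow> real^'m^'n \<Rightarrow> real^'r^'n \<Rightarrow> real^'n^'n \<Rightarrow> real^'m^'m \<Rightarrow> nat \<Rightarrow>
   (real^'n) measure set \<Rightarrow> (real^'r) measure set \<Rightarrow> 'a risk \<Rightarrow>
   ('n::finite, 'm::finite) policy \<Rightarrow> ereal"
  where "worst_case_risk A B D Q R T \<P>0 \<P>w \<rho> \<pi> =
    Sup {\<rho> M (cost Q R T \<pi> x) | M x w. \<exists>P0\<in>\<P>0. \<exists>Pw\<in>\<P>w. admissible A B D T \<pi> P0 Pw M x w}"

definition pseudo_regret ::
  "real^'n^'n \<Rightarrow> real^'m^'m \<Rightarrow> nat \<Rightarrow> ('n::finite, 'm::finite) policy \<Rightarrow>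
   'a measure \<Rightarrow> (nat \<Rightarrow> 'a \<Rightarrow> real^'n) \<Rightarrow> 'a measure \<Rightarrow> (nat \<Rightarrow> 'a \<Rightarrow> real^'n) \<Rightarrow> real"
  where "pseudo_regret Q R T \<pi> M x M' x' =
    prob_space.expectation M (cost Q R T \<pi> x) - prob_space.expectation M' (cost Q R T \<pi> x')"

end

theory Submission
  imports Defs
begin

text \<open>
  In closed loop \<open>x\<^sub>k\<^sub>+\<^sub>1 = G\<^sub>k x\<^sub>k + D w\<^sub>k\<close> with \<open>G\<^sub>k = A + B K\<^sub>k\<close>. Inductively \<open>E[x\<^sub>k w\<^sub>j\<^sup>T] = 0\<close> for \<open>j \<ge> k\<close>,
  so the cross terms vanish and \<open>S\<^sub>k = E[x\<^sub>k x\<^sub>k\<^sup>T]\<close> satisfies \<open>S\<^sub>k\<^sub>+\<^sub>1 = G\<^sub>k S\<^sub>k G\<^sub>k\<^sup>T + D \<Sigma>\<^sub>w D\<^sup>T\<close>.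
  Hence \<open>S\<^sub>k\<close>, and with it the expected quadratic cost, depends only on the data that all laws
  in the ambiguity sets share.
\<close>

section \<open>Outer products, traces and matrix products as bounded linear maps\<close>

lemma bounded_bilinear_outer: "bounded_bilinear (outer :: real^'i \<Rightarrow> real^'j \<Rightarrow> real^'j^'i)"
  unfolding bilinear_conv_bounded_bilinear[symmetric] bilinear_def
  by (auto intro!: linearI simp: outer_def vec_eq_iff algebra_simps)

interpretation outer: bounded_bilinear "outer :: real^'i \<Rightarrow> real^'j \<Rightarrow> real^'j^'i"
  by (rule bounded_bilinear_outer)

lemma outer_mult_left: "outer (G *v x) y = G ** outer x y"
  by (simp add: outer_def vec_eq_iff matrix_vector_mult_def matrix_matrix_mult_def
      sum_distrib_right mult.assoc)

lemma outer_mult_right: "outer x (G *v y) = outer x y ** transpose G"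
  by (simp add: outer_def vec_eq_iff matrix_vector_mult_def matrix_matrix_mult_def
      transpose_def sum_distrib_left mult_ac)

text \<open>Both sides are the double sum of \<open>x $ i * Q $ i $ j * x $ j\<close>. In this form
  the quadratic cost is linear in \<open>outer x x\<close>, so its expectation is determined by the
  second moment matrix.\<close>

lemma quad_norm_eq_trace: "quad_norm Q x = trace (Q ** outer x x)"
  by (simp add: quad_norm_def trace_def outer_def inner_vec_def matrix_vector_mult_def
      matrix_matrix_mult_def sum_distrib_left mult_ac)

text \<open>In finite dimension linearity already gives boundedness, which is what allows a constant
  matrix to be pulled out of a Bochner integral.\<close>

lemma bounded_linear_matrix_mult_left: "bounded_linear (\<lambda>M. (G :: real^'j^'i) ** (M :: real^'k^'j))"
  by (rule linear_conv_bounded_linear[THEN iffD1], rule linearI)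
    (simp_all add: vec_eq_iff matrix_matrix_mult_def sum_distrib_left algebra_simps sum.distrib)

lemma bounded_linear_matrix_mult_right: "bounded_linear (\<lambda>M. (M :: real^'j^'i) ** (G :: real^'k^'j))"
  by (rule linear_conv_bounded_linear[THEN iffD1], rule linearI)
    (simp_all add: vec_eq_iff matrix_matrix_mult_def sum_distrib_left algebra_simps sum.distrib)

lemma bounded_linear_trace: "bounded_linear (trace :: real^'i^'i \<Rightarrow> real)"
  by (rule linear_conv_bounded_linear[THEN iffD1], rule linearI)
    (simp_all add: trace_def sum.distrib sum_distrib_left)

section \<open>Square-integrable random vectors and their cross moments\<close>

definition square_integrable :: "'a measure \<Rightarrow> ('a \<Rightarrow> real^'i) \<Rightarrow> bool"
  where "square_integrable M X \<longleftrightarrow> X \<in> borel_measurable M \<and> integrable M (\<lambda>\<omega>. (norm (X \<omega>))\<^sup>2)"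

text \<open>Boundedness of \<open>outer\<close> gives a domination by a multiple of the product of
  the norms, hence of the sum of their squares.\<close>

lemma square_integrable_outer:
  assumes "square_integrable M X" "square_integrable M Y"
  shows "integrable M (\<lambda>\<omega>. outer (X \<omega>) (Y \<omega>))"
proof -
  obtain C where C: "\<And>a b. norm (outer (a :: real^'b) (b :: real^'c)) \<le> norm a * norm b * C" "C \<ge> 0"
    using outer.nonneg_bounded by blast
  have m[measurable]: "X \<in> borel_measurable M" "Y \<in> borel_measurable M"
    using assms by (auto simp: square_integrable_def)
  have "(\<lambda>\<omega>. outer (X \<omega>) (Y \<omega>)) \<in> borel_measurable M"
    unfolding outer_def by (intro borel_measurable_continuous_Pair[OF m]) (intro continuous_intros)
  moreover have "integrable M (\<lambda>\<omega>. ((norm (X \<omega>))\<^sup>2 + (norm (Y \<omega>))\<^sup>2) * C)"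
    using assms by (auto simp: square_integrable_def)
  moreover have "norm (outer (X \<omega>) (Y \<omega>)) \<le> norm (((norm (X \<omega>))\<^sup>2 + (norm (Y \<omega>))\<^sup>2) * C)" for \<omega>
  proof -
    \<comment> \<open>From 2ab \<le> a^2 + b^2 and ab \<ge> 0; the missing factor 1/2 is immaterial
      for domination.\<close>
    have "norm (X \<omega>) * norm (Y \<omega>) \<le> (norm (X \<omega>))\<^sup>2 + (norm (Y \<omega>))\<^sup>2"
      using sum_squares_bound[of "norm (X \<omega>)" "norm (Y \<omega>)"]
        mult_nonneg_nonneg[OF norm_ge_zero[of "X \<omega>"] norm_ge_zero[of "Y \<omega>"]] by linarith
    then show ?thesis
      using C(1)[of "X \<omega>" "Y \<omega>"] mult_right_mono[OF _ C(2)] C(2) by (fastforce simp: abs_mult)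
  qed
  ultimately show ?thesis
    by (intro Bochner_Integration.integrable_bound[of M _ "\<lambda>\<omega>. outer (X \<omega>) (Y \<omega>)"] AE_I2)
qed

lemma square_integrable_add:
  assumes "square_integrable M X" "square_integrable M Y"
  shows "square_integrable M (\<lambda>\<omega>. X \<omega> + Y \<omega>)"
proof -
  have [measurable]: "X \<in> borel_measurable M" "Y \<in> borel_measurable M"
    using assms by (auto simp: square_integrable_def)
  have "integrable M (\<lambda>\<omega>. 2 * (norm (X \<omega>))\<^sup>2 + 2 * (norm (Y \<omega>))\<^sup>2)"
    using assms by (auto simp: square_integrable_def)
  moreover have "(norm (X \<omega> + Y \<omega>))\<^sup>2 \<le> 2 * (norm (X \<omega>))\<^sup>2 + 2 * (norm (Y \<omega>))\<^sup>2" for \<omega>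
    using power_mono[OF norm_triangle_ineq[of "X \<omega>" "Y \<omega>"] norm_ge_zero, of 2]
      sum_squares_bound[of "norm (X \<omega>)" "norm (Y \<omega>)"]
    by (simp add: power2_sum)
  ultimately show ?thesis
    unfolding square_integrable_def by (auto intro: Bochner_Integration.integrable_bound)
qed

lemma square_integrable_matrix_vector:
  assumes "square_integrable M X"
  shows "square_integrable M (\<lambda>\<omega>. G *v X \<omega>)"
proof -
  have m[measurable]: "X \<in> borel_measurable M"
    using assms by (auto simp: square_integrable_def)
  have [measurable]: "(\<lambda>\<omega>. G *v X \<omega>) \<in> borel_measurable M"
    by (rule borel_measurable_continuous_on[OF matrix_vector_mult_linear_continuous_on m])
  obtain C where C: "\<And>v. norm (G *v v) \<le> norm v * C"
    using bounded_linear.bounded[OF matrix_vector_mul_bounded_linear] by blast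
  have "integrable M (\<lambda>\<omega>. (norm (X \<omega>))\<^sup>2 * C\<^sup>2)"
    using assms by (auto simp: square_integrable_def)
  moreover have "(norm (G *v X \<omega>))\<^sup>2 \<le> (norm (X \<omega>))\<^sup>2 * C\<^sup>2" for \<omega>
    using power_mono[OF C[of "X \<omega>"] norm_ge_zero, of 2] by (simp add: power_mult_distrib)
  ultimately have "integrable M (\<lambda>\<omega>. (norm (G *v X \<omega>))\<^sup>2)"
    by - (erule Bochner_Integration.integrable_bound, simp_all)
  then show ?thesis
    by (simp add: square_integrable_def)
qed

lemma integral_outer_mult_left:
  assumes "square_integrable M X" "square_integrable M Y"
  shows "(\<integral>\<omega>. outer (G *v X \<omega>) (Y \<omega>) \<partial>M) = G ** (\<integral>\<omega>. outer (X \<omega>) (Y \<omega>) \<partial>M)"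
  unfolding outer_mult_left
  by (rule integral_bounded_linear[OF bounded_linear_matrix_mult_left square_integrable_outer[OF assms]])

lemma integral_outer_mult_right:
  assumes "square_integrable M X" "square_integrable M Y"
  shows "(\<integral>\<omega>. outer (X \<omega>) (G *v Y \<omega>) \<partial>M) = (\<integral>\<omega>. outer (X \<omega>) (Y \<omega>) \<partial>M) ** transpose G"
  unfolding outer_mult_right
  by (rule integral_bounded_linear[OF bounded_linear_matrix_mult_right square_integrable_outer[OF assms]])

lemma transpose_outer: "transpose (outer x y) = outer y x"
  by (simp add: outer_def transpose_def vec_eq_iff mult.commute)

lemma transpose_zero: "transpose (0 :: real^'j^'i) = 0"
  by (simp add: transpose_def vec_eq_iff)

text \<open>Transposition is bounded linear and swaps the factors of an outer product. Thus once
  E[x w^T] vanishes, so does E[w x^T].\<close>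

lemma integral_outer_commute:
  fixes X :: "'a \<Rightarrow> real^'i" and Y :: "'a \<Rightarrow> real^'j"
  assumes "square_integrable M X" "square_integrable M Y"
  shows "(\<integral>\<omega>. outer (Y \<omega>) (X \<omega>) \<partial>M) = transpose (\<integral>\<omega>. outer (X \<omega>) (Y \<omega>) \<partial>M)"
proof -
  have "bounded_linear (transpose :: real^'j^'i \<Rightarrow> _)"
    by (rule linear_conv_bounded_linear[THEN iffD1], rule linearI) (simp_all add: transpose_def vec_eq_iff)
  from integral_bounded_linear[OF this square_integrable_outer[OF assms]] show ?thesis
    by (simp add: transpose_outer)
qed

lemma integral_quad_norm:
  assumes "square_integrable M X"
  shows "integrable M (\<lambda>\<omega>. quad_norm Q (X \<omega>))"
    and "(\<integral>\<omega>. quad_norm Q (X \<omega>) \<partial>M) = trace (Q ** (\<integral>\<omega>. outer (X \<omega>) (X \<omega>) \<partial>M))"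
proof -
  have *: "bounded_linear (\<lambda>S. trace (Q ** S))"
    by (rule bounded_linear_compose[OF bounded_linear_trace bounded_linear_matrix_mult_left])
  note i = square_integrable_outer[OF assms assms]
  show "integrable M (\<lambda>\<omega>. quad_norm Q (X \<omega>))"
    unfolding quad_norm_eq_trace by (rule integrable_bounded_linear[OF * i])
  show "(\<integral>\<omega>. quad_norm Q (X \<omega>) \<partial>M) = trace (Q ** (\<integral>\<omega>. outer (X \<omega>) (X \<omega>) \<partial>M))"
    unfolding quad_norm_eq_trace by (rule integral_bounded_linear[OF * i])
qed

section \<open>Means, second moments and independence on a probability space\<close>

lemma (in prob_space) square_integrable_imp_integrable:
  assumes "square_integrable M X"
  shows "integrable M X"
proof -
  \<comment> \<open>Domination by t \<le> t^2 + 1; the constant 1 is integrable because the measure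
    is finite.\<close>
  have "integrable M (\<lambda>\<omega>. (norm (X \<omega>))\<^sup>2 + 1)"
    using assms by (auto simp: square_integrable_def)
  moreover have "norm (X \<omega>) \<le> (norm (X \<omega>))\<^sup>2 + 1" for \<omega>
    using sum_squares_bound[of "norm (X \<omega>)" 1] norm_ge_zero[of "X \<omega>"]
    by (simp del: norm_ge_zero)
  ultimately show ?thesis
    using assms
    by - (erule Bochner_Integration.integrable_bound, simp_all add: square_integrable_def)
qed

text \<open>The moments of the law are carried back to \<open>X\<close> by change of variables. The
  cost involves uncentred second moments, so the covariance is expanded: each cross term integrates
  to \<open>outer \<mu> \<mu>\<close>, as does the constant term since the total mass is 1.\<close>

lemma ambiguity_set_distr:
  assumes "prob_space M" "X \<in> borel_measurable M" "distr M borel X \<in> ambiguity_set \<mu> \<Sigma>"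
  shows "square_integrable M X"
    and "(\<integral>\<omega>. X \<omega> \<partial>M) = \<mu>"
    and "(\<integral>\<omega>. outer (X \<omega>) (X \<omega>) \<partial>M) = \<Sigma> + outer \<mu> \<mu>"
proof -
  interpret prob_space M by fact
  have [measurable]: "X \<in> borel_measurable M" by fact
  have o[measurable]: "(\<lambda>v. outer (v - \<mu>) (v - \<mu>)) \<in> borel_measurable borel"
    unfolding outer_def by (intro borel_measurable_continuous_onI continuous_intros)
  have 1: "integrable (distr M borel X) (\<lambda>v. (norm v)\<^sup>2)"
    and 2: "(\<integral>v. v \<partial>distr M borel X) = \<mu>"
    and 3: "(\<integral>v. outer (v - \<mu>) (v - \<mu>) \<partial>distr M borel X) = \<Sigma>"
    using assms by (auto simp: ambiguity_set_def)
  show sq: "square_integrable M X"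
    using 1 by (simp add: square_integrable_def integrable_distr_eq)
  show mean: "(\<integral>\<omega>. X \<omega> \<partial>M) = \<mu>"
    using 2 by (subst (asm) integral_distr) auto
  have cov: "(\<integral>\<omega>. outer (X \<omega> - \<mu>) (X \<omega> - \<mu>) \<partial>M) = \<Sigma>"
    using 3 by (subst (asm) integral_distr) auto
  note ix = square_integrable_imp_integrable[OF sq]
  note ii = square_integrable_outer[OF sq sq]
  have l: "integrable M (\<lambda>\<omega>. outer \<mu> (X \<omega>))" "(\<integral>\<omega>. outer \<mu> (X \<omega>) \<partial>M) = outer \<mu> \<mu>"
    using integrable_bounded_linear[OF outer.bounded_linear_right ix]
      integral_bounded_linear[OF outer.bounded_linear_right ix] mean by auto
  have r: "integrable M (\<lambda>\<omega>. outer (X \<omega>) \<mu>)" "(\<integral>\<omega>. outer (X \<omega>) \<mu> \<partial>M) = outer \<mu> \<mu>"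
    using integrable_bounded_linear[OF outer.bounded_linear_left ix]
      integral_bounded_linear[OF outer.bounded_linear_left ix] mean by auto
  show "(\<integral>\<omega>. outer (X \<omega>) (X \<omega>) \<partial>M) = \<Sigma> + outer \<mu> \<mu>"
    using cov ii l r
    by (simp add: outer.diff_left outer.diff_right prob_space algebra_simps)
qed

text \<open>The vectors may differ in dimension, so the claim is reduced to entries: coordinates of
  independent vectors are independent real variables, for which the expectation of a product
  factors.\<close>

lemma (in prob_space) indep_rv_integral_outer:
  fixes X :: "'a \<Rightarrow> real^'i" and Y :: "'a \<Rightarrow> real^'j"
  assumes ind: "indep_rv M X Y" and sX: "square_integrable M X" and sY: "square_integrable M Y"
  shows "(\<integral>\<omega>. outer (X \<omega>) (Y \<omega>) \<partial>M) = outer (expectation X) (expectation Y)"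
proof -
  have [measurable]: "X \<in> borel_measurable M" "Y \<in> borel_measurable M"
    using ind by (auto simp: indep_rv_def)
  note iX = square_integrable_imp_integrable[OF sX] and iY = square_integrable_imp_integrable[OF sY]
  note iXY = square_integrable_outer[OF sX sY]
  \<comment> \<open>The components are left in a general Euclidean space so that the fact applies
    twice to a matrix-valued integral: first to extract a row, then an entry.\<close>
  have comp: "integrable N (\<lambda>\<omega>. f \<omega> $ i)" "(\<integral>\<omega>. f \<omega> \<partial>N) $ i = (\<integral>\<omega>. f \<omega> $ i \<partial>N)"
    if "integrable N f" for N :: "'a measure" and f :: "'a \<Rightarrow> ('b::euclidean_space)^'k" and i
    using integrable_bounded_linear[OF bounded_linear_vec_nth that]
      integral_bounded_linear[OF bounded_linear_vec_nth that] by simp_all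
  have "(\<integral>\<omega>. X \<omega> $ i * Y \<omega> $ j \<partial>M) = expectation X $ i * expectation Y $ j" for i j
  proof -
    \<comment> \<open>A coordinate of \<open>Z\<close> is a continuous function of \<open>Z\<close>,
      so the sigma-algebra it generates lies inside the one generated by \<open>Z\<close>.
      Independence then passes to these smaller sigma-algebras by
      \<open>indep_sets_mono\<close>.\<close>
    have sub: "sigma_sets (space M) {(\<lambda>\<omega>. Z \<omega> $ k) -` S \<inter> space M | S. S \<in> sets borel}
        \<subseteq> {Z -` S \<inter> space M | S. S \<in> sets borel}" for Z :: "'a \<Rightarrow> real^'k" and k
    proof -
      have "(\<lambda>\<omega>. Z \<omega> $ k) \<in> measurable (vimage_algebra (space M) Z borel) borel"
        by (rule measurable_compose[OF measurable_vimage_algebra1])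
          (auto intro!: borel_measurable_continuous_onI continuous_on_component)
      from sets_image_in_sets[OF space_vimage_algebra this] show ?thesis
        unfolding sets_vimage_algebra[of _ "\<lambda>\<omega>. Z \<omega> $ k"] by (simp add: sets_vimage_algebra2)
    qed
    have "indep_set {X -` S \<inter> space M | S. S \<in> sets borel} {Y -` S \<inter> space M | S. S \<in> sets borel}"
      using ind by (auto simp: indep_rv_def)
    then have "indep_var borel (\<lambda>\<omega>. X \<omega> $ i) borel (\<lambda>\<omega>. Y \<omega> $ j)"
      unfolding indep_var_eq indep_set_def
      using sub[of X i] sub[of Y j]
        borel_measurable_integrable[OF comp(1)[OF iX]] borel_measurable_integrable[OF comp(1)[OF iY]]
      by (intro conjI) (assumption | erule indep_sets_mono | simp split: bool.split)+
    then show ?thesis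
      using indep_var_lebesgue_integral[of "\<lambda>\<omega>. X \<omega> $ i" "\<lambda>\<omega>. Y \<omega> $ j"] comp[OF iX] comp[OF iY]
      by simp
  qed
  then show ?thesis
    unfolding vec_eq_iff comp(2)[OF iXY] comp(2)[OF comp(1)[OF iXY]] by (simp add: outer_def)
qed

section \<open>The second moments of the state: a discrete-time Lyapunov recursion\<close>

fun second_moment ::
  "(nat \<Rightarrow> real^'n^'n) \<Rightarrow> real^'n^'n \<Rightarrow> real^'n^'n \<Rightarrow> nat \<Rightarrow> real^'n^'n"
  where
    "second_moment G V S 0 = S"
  | "second_moment G V S (Suc k) = G k ** second_moment G V S k ** transpose (G k) + V"

text \<open>The three claims need each other in the induction: square integrability lets integrals
  of sums split, and orthogonality removes the cross terms from the recursion. Orthogonality is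
  claimed for \<open>j\<close> from \<open>k\<close> on, including \<open>k\<close> itself, because
  \<open>x k\<close> depends only on earlier disturbances while \<open>w k\<close> is the one that
  enters the step to \<open>x (Suc k)\<close>.\<close>

lemma admissible_second_moment:
  fixes A :: "real^'n^'n" and B :: "real^'m^'n" and D :: "real^'r^'n" and K :: "nat \<Rightarrow> real^'n^'m"
  assumes adm: "admissible A B D T \<pi> P0 Pw M x w"
    and lin: "\<And>k v. k < T \<Longrightarrow> \<pi> k v = K k *v v"
    and P0: "P0 \<in> ambiguity_set \<mu>0 \<Sigma>0" and Pw: "Pw \<in> ambiguity_set 0 \<Sigma>w"
    and "k \<le> T"
  shows "square_integrable M (x k) \<and>
    (\<forall>j. k \<le> j \<and> j < T \<longrightarrow> (\<integral>\<omega>. outer (x k \<omega>) (w j \<omega>) \<partial>M) = 0) \<and>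
    (\<integral>\<omega>. outer (x k \<omega>) (x k \<omega>) \<partial>M)
      = second_moment (\<lambda>k. A + B ** K k) (D ** \<Sigma>w ** transpose D) (\<Sigma>0 + outer \<mu>0 \<mu>0) k"
  using \<open>k \<le> T\<close>
proof (induction k)
  interpret prob_space M using adm by (simp add: admissible_def)
  \<comment> \<open>The disturbances are centred, so their uncentred second moment is
    \<open>\<Sigma>w\<close> itself.\<close>
  have w: "square_integrable M (w j)" "expectation (w j) = 0"
    "(\<integral>\<omega>. outer (w j \<omega>) (w j \<omega>) \<partial>M) = \<Sigma>w" if "j < T" for j
    using ambiguity_set_distr[of M "w j" 0 \<Sigma>w] adm Pw that prob_space_axioms
    by (auto simp: admissible_def outer.zero_left)
  {
    case 0
    have "x 0 \<in> borel_measurable M" "distr M borel (x 0) \<in> ambiguity_set \<mu>0 \<Sigma>0"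
      using adm P0 by (auto simp: admissible_def)
    note x0 = ambiguity_set_distr[OF prob_space_axioms this]
    \<comment> \<open>Independence turns this into the outer product of the means, which is zero
      because \<open>w j\<close> has mean zero, whatever the mean \<open>\<mu>0\<close> of the
      initial state.\<close>
    moreover have "(\<integral>\<omega>. outer (x 0 \<omega>) (w j \<omega>) \<partial>M) = 0" if "j < T" for j
      using indep_rv_integral_outer[of "x 0" "w j"] adm x0 w[OF that] that
      by (auto simp: admissible_def outer.zero_right)
    ultimately show ?case by simp
  next
    case (Suc k)
    define G where "G = A + B ** K k"
    have k: "k < T" using Suc.prems by simp
    have sx: "square_integrable M (x k)"
      and xw: "\<And>j. k \<le> j \<Longrightarrow> j < T \<Longrightarrow> (\<integral>\<omega>. outer (x k \<omega>) (w j \<omega>) \<partial>M) = 0"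
      and S: "(\<integral>\<omega>. outer (x k \<omega>) (x k \<omega>) \<partial>M)
        = second_moment (\<lambda>k. A + B ** K k) (D ** \<Sigma>w ** transpose D) (\<Sigma>0 + outer \<mu>0 \<mu>0) k"
      using Suc.IH k by auto
    have step: "x (Suc k) \<omega> = G *v x k \<omega> + D *v w k \<omega>" if "\<omega> \<in> space M" for \<omega>
      using adm k lin[OF k] that
      by (simp add: admissible_def G_def matrix_vector_mult_add_rdistrib matrix_vector_mul_assoc)
    note sGx = square_integrable_matrix_vector[OF sx, of G]
    note sDw = square_integrable_matrix_vector[OF w(1)[OF k], of D]
    \<comment> \<open>The dynamics hold only on \<open>space M\<close>, so the two functions need
      not be equal everywhere; the property is transferred by congruence instead of
      rewriting.\<close>
    have "square_integrable M (x (Suc k)) \<longleftrightarrow> square_integrable M (\<lambda>\<omega>. G *v x k \<omega> + D *v w k \<omega>)"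
      unfolding square_integrable_def
      by (intro conj_cong measurable_cong Bochner_Integration.integrable_cong refl)
        (simp_all add: step)
    then have sx': "square_integrable M (x (Suc k))"
      using square_integrable_add[OF sGx sDw] by simp
    have xw': "(\<integral>\<omega>. outer (x (Suc k) \<omega>) (w j \<omega>) \<partial>M) = 0" if "Suc k \<le> j" "j < T" for j
    proof -
      note swj = w(1)[OF that(2)]
      have "(\<integral>\<omega>. outer (x (Suc k) \<omega>) (w j \<omega>) \<partial>M)
          = (\<integral>\<omega>. outer (G *v x k \<omega>) (w j \<omega>) + outer (D *v w k \<omega>) (w j \<omega>) \<partial>M)"
        by (intro Bochner_Integration.integral_cong refl) (simp add: step outer.add_left)
      also have "\<dots> = G ** (\<integral>\<omega>. outer (x k \<omega>) (w j \<omega>) \<partial>M) + D ** (\<integral>\<omega>. outer (w k \<omega>) (w j \<omega>) \<partial>M)"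
        using square_integrable_outer[OF sGx swj] square_integrable_outer[OF sDw swj]
        by (simp add: integral_outer_mult_left[OF sx swj] integral_outer_mult_left[OF w(1)[OF k] swj])
      \<comment> \<open>The first term vanishes by the induction hypothesis, since j > k; the second
        because distinct disturbances are uncorrelated.\<close>
      also have "\<dots> = 0"
        using xw[of j] that adm k by (auto simp: admissible_def)
      finally show ?thesis .
    qed
    note wk = w(1)[OF k]
    have "(\<integral>\<omega>. outer (x (Suc k) \<omega>) (x (Suc k) \<omega>) \<partial>M)
        = (\<integral>\<omega>. (outer (G *v x k \<omega>) (G *v x k \<omega>) + outer (G *v x k \<omega>) (D *v w k \<omega>))
            + (outer (D *v w k \<omega>) (G *v x k \<omega>) + outer (D *v w k \<omega>) (D *v w k \<omega>)) \<partial>M)"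
      by (intro Bochner_Integration.integral_cong refl)
        (simp add: step outer.add_left outer.add_right)
    \<comment> \<open>The second cross moment is written as the transpose of the first, so that
      orthogonality of \<open>x k\<close> and \<open>w k\<close> removes both in the next
      step.\<close>
    also have "\<dots> = G ** (\<integral>\<omega>. outer (x k \<omega>) (x k \<omega>) \<partial>M) ** transpose G
        + G ** (\<integral>\<omega>. outer (x k \<omega>) (w k \<omega>) \<partial>M) ** transpose D
        + (D ** transpose (\<integral>\<omega>. outer (x k \<omega>) (w k \<omega>) \<partial>M) ** transpose G
        + D ** (\<integral>\<omega>. outer (w k \<omega>) (w k \<omega>) \<partial>M) ** transpose D)"
      using square_integrable_outer[OF sGx sGx] square_integrable_outer[OF sGx sDw]
        square_integrable_outer[OF sDw sGx] square_integrable_outer[OF sDw sDw]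
      by (simp add: integral_outer_mult_left[OF sx sGx] integral_outer_mult_left[OF sx sDw]
          integral_outer_mult_left[OF wk sGx] integral_outer_mult_left[OF wk sDw]
          integral_outer_mult_right[OF sx sx] integral_outer_mult_right[OF sx wk]
          integral_outer_mult_right[OF wk sx] integral_outer_mult_right[OF wk wk]
          integral_outer_commute[OF sx wk] matrix_mul_assoc)
    also have "\<dots> = second_moment (\<lambda>k. A + B ** K k) (D ** \<Sigma>w ** transpose D)
        (\<Sigma>0 + outer \<mu>0 \<mu>0) (Suc k)"
      using xw[of k] k S w(3)[OF k] by (simp add: G_def transpose_zero)
    finally show ?case
      using sx' xw' by blast
  }
qed

text \<open>Linearity of expectation reduces each stage cost to a trace against a second moment; the
  input \<open>K k *v x k\<close> has second moment K S K^T. The resulting value mentions neither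
  \<open>P0\<close>, \<open>Pw\<close> nor the trajectory.\<close>

lemma admissible_expectation_cost:
  fixes A :: "real^'n^'n" and B :: "real^'m^'n" and D :: "real^'r^'n" and K :: "nat \<Rightarrow> real^'n^'m"
  assumes adm: "admissible A B D T \<pi> P0 Pw M x w"
    and lin: "\<And>k v. k < T \<Longrightarrow> \<pi> k v = K k *v v"
    and P0: "P0 \<in> ambiguity_set \<mu>0 \<Sigma>0" and Pw: "Pw \<in> ambiguity_set 0 \<Sigma>w"
  defines "S \<equiv> second_moment (\<lambda>k. A + B ** K k) (D ** \<Sigma>w ** transpose D) (\<Sigma>0 + outer \<mu>0 \<mu>0)"
  shows "prob_space.expectation M (cost Q R T \<pi> x)
    = trace (Q ** S T)
      + (\<Sum>k<T. trace (Q ** S k) + trace (R ** (K k ** S k ** transpose (K k))))"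
proof -
  have sx: "square_integrable M (x k)" and Sk: "(\<integral>\<omega>. outer (x k \<omega>) (x k \<omega>) \<partial>M) = S k"
    if "k \<le> T" for k
    using admissible_second_moment[OF adm lin P0 Pw that] by (auto simp: S_def)
  have cost: "cost Q R T \<pi> x = (\<lambda>\<omega>. quad_norm Q (x T \<omega>)
      + (\<Sum>k<T. quad_norm Q (x k \<omega>) + quad_norm R (K k *v x k \<omega>)))"
    by (rule ext) (simp add: cost_def lin)
  have q: "integrable M (\<lambda>\<omega>. quad_norm Q (x k \<omega>))"
    "(\<integral>\<omega>. quad_norm Q (x k \<omega>) \<partial>M) = trace (Q ** S k)"
    "integrable M (\<lambda>\<omega>. quad_norm R (K k *v x k \<omega>))"
    "(\<integral>\<omega>. quad_norm R (K k *v x k \<omega>) \<partial>M) = trace (R ** (K k ** S k ** transpose (K k)))"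
    if "k \<le> T" for k
  proof -
    note s = sx[OF that]
    note Ks = square_integrable_matrix_vector[OF s, of "K k"]
    show "integrable M (\<lambda>\<omega>. quad_norm Q (x k \<omega>))"
      "integrable M (\<lambda>\<omega>. quad_norm R (K k *v x k \<omega>))"
      "(\<integral>\<omega>. quad_norm Q (x k \<omega>) \<partial>M) = trace (Q ** S k)"
      "(\<integral>\<omega>. quad_norm R (K k *v x k \<omega>) \<partial>M) = trace (R ** (K k ** S k ** transpose (K k)))"
      using integral_quad_norm[OF s] integral_quad_norm[OF Ks] Sk[OF that]
      by (simp_all add: integral_outer_mult_left[OF s Ks] integral_outer_mult_right[OF s s]
          matrix_mul_assoc)
  qed
  have "prob_space.expectation M (cost Q R T \<pi> x) = (\<integral>\<omega>. quad_norm Q (x T \<omega>) \<partial>M)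
      + (\<Sum>k<T. \<integral>\<omega>. quad_norm Q (x k \<omega>) + quad_norm R (K k *v x k \<omega>) \<partial>M)"
    unfolding cost
    by (subst Bochner_Integration.integral_add)
      (auto intro!: Bochner_Integration.integral_sum Bochner_Integration.integrable_sum
        Bochner_Integration.integrable_add q)
  also have "\<dots> = trace (Q ** S T)
      + (\<Sum>k<T. trace (Q ** S k) + trace (R ** (K k ** S k ** transpose (K k))))"
    by (simp add: q)
  finally show ?thesis .
qed

theorem lemma2:
  fixes A :: "real^'n^'n" and B :: "real^'m^'n" and D :: "real^'r^'n"
    and Q :: "real^'n^'n" and R :: "real^'m^'m" and T :: nat
    and \<Sigma>w :: "real^'r^'r" and \<mu>0 :: "real^'n" and \<Sigma>0 :: "real^'n^'n"
    and \<rho> :: "'a risk"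
    and \<pi> :: "('n, 'm) policy" and K :: "nat \<Rightarrow> real^'n^'m"
    and M_true M_worst :: "'a measure"
    and x_true x_worst :: "nat \<Rightarrow> 'a \<Rightarrow> real^'n"
    and w_true w_worst :: "nat \<Rightarrow> 'a \<Rightarrow> real^'r"
    and P0_true P0_worst :: "(real^'n) measure"
    and Pw_true Pw_worst :: "(real^'r) measure"
  assumes "stabilizable A B" and "controllable A B"
    and "pos_semidef Q" and "pos_def R"
    and "risk_functional \<rho>" and "\<not> is_expectation \<rho>"
    and "\<And>k v. k < T \<Longrightarrow> \<pi> k v = K k *v v"
    and "is_arg_min
           (worst_case_risk A B D Q R T (ambiguity_set \<mu>0 \<Sigma>0) (ambiguity_set 0 \<Sigma>w) \<rho>)
           (\<lambda>\<pi>'. \<pi>' \<in> linear_policies T) \<pi>"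
    and "P0_true \<in> ambiguity_set \<mu>0 \<Sigma>0" and "Pw_true \<in> ambiguity_set 0 \<Sigma>w"
    and "P0_worst \<in> ambiguity_set \<mu>0 \<Sigma>0" and "Pw_worst \<in> ambiguity_set 0 \<Sigma>w"
    and "admissible A B D T \<pi> P0_true Pw_true M_true x_true w_true"
    and "admissible A B D T \<pi> P0_worst Pw_worst M_worst x_worst w_worst"
  shows "pseudo_regret Q R T \<pi> M_true x_true M_worst x_worst = 0"
  \<comment> \<open>Both trajectories share the gains and the prescribed moments, so the two
    expectations equal the same closed expression and cancel.\<close>
  using admissible_expectation_cost[OF assms(13,7,9,10)] admissible_expectation_cost[OF assms(14,7,11,12)]
  by (simp add: pseudo_regret_def)

end
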